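(* Let $\mathbb{K}$ be an algebraically closed field of characteristic zero, let $(\mathfrak{g},\mu)$ be a finite-dimensional Lie algebra over $\mathbb{K}$ and let $\mathfrak{h}\subseteq\mathfrak{g}$ be a Lie subalgebra of codimension $2$. Fix $a_1,a_2\in\mathfrak{g}$ such that $\mathfrak{g}=\langle a_1,a_2\rangle\oplus\mathfrak{h}$ (direct sum of vector spaces), and let $a_1^*,a_2^*\in\mathfrak{g}^*$ be the linear functionals with $a_i^*(a_j)=\delta_{ij}$ and $a_i^*|_{\mathfrak{h}}=0$. Assume that $a_1^*(\mu(a_1,h))+a_2^*(\mu(a_2,h))=0$ for all $h\in\mathfrak{h}$. Then for every $y\in\mathfrak{g}$ with $\mu(y,h)=0$ for all $h\in\mathfrak{h}$, the family $$\mu_t=\mu+t\,(a_1^*\wedge a_2^*\otimes y),\qquad t\in\mathbb{K},$$ is a linear deformation of $\mu$; that is, $\mu_t$ is a Lie bracket on $\mathfrak{g}$ for every $t\in\mathbb{K}$.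
   Context: For $y\in\mathfrak{g}$, $a_1^*\wedge a_2^*\otimes y$ is the antisymmetric bilinear map $\mathfrak{g}\times\mathfrak{g}\to\mathfrak{g}$ given by $(u,v)\mapsto (a_1^*(u)a_2^*(v)-a_2^*(u)a_1^*(v))\,y$. A linear deformation of a Lie bracket $\mu$ is a family $\mu_t=\mu+t\varphi$, $t\in\mathbb{K}$, with $\varphi$ an antisymmetric bilinear map, such that $\mu_t$ is a Lie bracket for all $t\in\mathbb{K}$. *)

theory Defs
  imports "HOL-Computational_Algebra.Polynomial"
begin

text \<open>
  The vector space \<open>\<gg>\<close> is a whole type \<open>'g\<close> of class \<open>ab_group_add\<close> together with a scalar
  multiplication \<open>scale\<close> by elements of \<open>'k\<close>, as in the locale \<open>vector_space\<close>.
\<close>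

definition bilinear_map :: "('k::field \<Rightarrow> 'g::ab_group_add \<Rightarrow> 'g) \<Rightarrow> ('g \<Rightarrow> 'g \<Rightarrow> 'g) \<Rightarrow> bool"
  where "bilinear_map scale B \<longleftrightarrow>
    (\<forall>u. Vector_Spaces.linear scale scale (\<lambda>v. B u v)) \<and>
    (\<forall>v. Vector_Spaces.linear scale scale (\<lambda>u. B u v))"

text \<open>
  Antisymmetry is the condition \<open>B u v = - B v u\<close>. It agrees with \<open>B u u = 0\<close> only away from
  characteristic 2, hence the restriction to characteristic zero.
\<close>

definition antisymmetric_bilinear ::
    "('k::field_char_0 \<Rightarrow> 'g::ab_group_add \<Rightarrow> 'g) \<Rightarrow> ('g \<Rightarrow> 'g \<Rightarrow> 'g) \<Rightarrow> bool"
  where "antisymmetric_bilinear scale B \<longleftrightarrow>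
    bilinear_map scale B \<and> (\<forall>u v. B u v = - B v u)"

definition lie_bracket ::
    "('k::field_char_0 \<Rightarrow> 'g::ab_group_add \<Rightarrow> 'g) \<Rightarrow> ('g \<Rightarrow> 'g \<Rightarrow> 'g) \<Rightarrow> bool"
  where "lie_bracket scale \<mu> \<longleftrightarrow>
    antisymmetric_bilinear scale \<mu> \<and>
    (\<forall>u v w. \<mu> (\<mu> u v) w + \<mu> (\<mu> v w) u + \<mu> (\<mu> w u) v = 0)"

definition lie_subalgebra ::
    "('k::field_char_0 \<Rightarrow> 'g::ab_group_add \<Rightarrow> 'g) \<Rightarrow> ('g \<Rightarrow> 'g \<Rightarrow> 'g) \<Rightarrow> 'g set \<Rightarrow> bool"
  where "lie_subalgebra scale \<mu> H \<longleftrightarrow>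
    module.subspace scale H \<and> (\<forall>u\<in>H. \<forall>v\<in>H. \<mu> u v \<in> H)"

definition direct_sum_decomposition ::
    "('k::field \<Rightarrow> 'g::ab_group_add \<Rightarrow> 'g) \<Rightarrow> 'g set \<Rightarrow> 'g set \<Rightarrow> bool"
  where "direct_sum_decomposition scale U W \<longleftrightarrow>
    module.subspace scale U \<and> module.subspace scale W \<and>
    U \<inter> W = {0} \<and> (\<forall>x. \<exists>u\<in>U. \<exists>w\<in>W. x = u + w)"

text \<open>The map \<open>f \<and> g \<otimes> y\<close> for linear functionals \<open>f\<close>, \<open>g\<close>.\<close>

definition wedge_tensor ::
    "('k::field \<Rightarrow> 'g::ab_group_add \<Rightarrow> 'g) \<Rightarrow> ('g \<Rightarrow> 'k) \<Rightarrow> ('g \<Rightarrow> 'k) \<Rightarrow> 'g \<Rightarrow> 'g \<Rightarrow> 'g \<Rightarrow> 'g"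
  where "wedge_tensor scale f g y = (\<lambda>u v. scale (f u * g v - g u * f v) y)"

definition linear_deformation ::
    "('k::field_char_0 \<Rightarrow> 'g::ab_group_add \<Rightarrow> 'g) \<Rightarrow> ('g \<Rightarrow> 'g \<Rightarrow> 'g) \<Rightarrow>
      ('k \<Rightarrow> 'g \<Rightarrow> 'g \<Rightarrow> 'g) \<Rightarrow> bool"
  where "linear_deformation scale \<mu> M \<longleftrightarrow>
    (\<exists>\<phi>. antisymmetric_bilinear scale \<phi> \<and> M = (\<lambda>t u v. \<mu> u v + scale t (\<phi> u v))) \<and>
    (\<forall>t. lie_bracket scale (M t))"

end

theory Submission
  imports Defs
begin

text \<open>
  Write \<open>\<omega> = f\<^sub>1 \<and> f\<^sub>2\<close> and \<open>\<phi> = \<omega> \<otimes> y\<close>. The Jacobi sum of \<open>\<mu> + t \<phi>\<close> is a polynomial of degree 2 in \<open>t\<close>.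
  The coefficient of \<open>t\<^sup>2\<close> is the cyclic sum of \<open>\<omega>(u,v) \<omega>(y,w) y\<close>, which vanishes because \<open>\<omega>\<close> is
  decomposable. The coefficient of \<open>t\<close> consists of the cyclic sums of \<open>\<omega>(u,v) \<mu>(y,w)\<close> and of
  \<open>\<omega>(\<mu>(u,v),w) y\<close>. In the first, \<open>\<mu>(y,\<cdot>)\<close> kills \<open>\<hh>\<close>, so it factors through \<open>f\<^sub>1, f\<^sub>2\<close>, and what
  remains are three-by-three determinants with a repeated row. The second is, up to sign, \<open>d\<omega>\<close>; since \<open>\<hh>\<close> is
  a subalgebra of codimension 2, only its values at \<open>(a\<^sub>1, a\<^sub>2, h)\<close> matter, and these are the trace
  expression assumed to be zero.
\<close>

lemma bilinear_mapD:
  assumes "bilinear_map scale B"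
  shows "B (u + u') v = B u v + B u' v" "B u (v + v') = B u v + B u v'"
    "B (scale c u) v = scale c (B u v)" "B u (scale c v) = scale c (B u v)"
  using assms unfolding bilinear_map_def
  by (auto simp: Vector_Spaces.linear_iff)

lemma antisymmetric_bilinear_wedge_tensor:
  fixes scale :: "'k::field_char_0 \<Rightarrow> 'g::ab_group_add \<Rightarrow> 'g"
  assumes f: "Vector_Spaces.linear scale (*) f" and g: "Vector_Spaces.linear scale (*) g"
  shows "antisymmetric_bilinear scale (wedge_tensor scale f g y)"
proof -
  interpret vector_space scale
    using f by (simp add: Vector_Spaces.linear_iff)
  show ?thesis
    using f g vector_space_axioms
    by (auto simp: antisymmetric_bilinear_def bilinear_map_def Vector_Spaces.linear_iff
        wedge_tensor_def algebra_simps)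
qed

lemma antisymmetric_bilinear_add_scale:
  fixes scale :: "'k::field_char_0 \<Rightarrow> 'g::ab_group_add \<Rightarrow> 'g"
  assumes "vector_space scale"
    and B: "antisymmetric_bilinear scale B" and C: "antisymmetric_bilinear scale C"
  shows "antisymmetric_bilinear scale (\<lambda>u v. B u v + scale t (C u v))"
proof -
  interpret vector_space scale by fact
  have bil: "bilinear_map scale B" "bilinear_map scale C"
    and anti: "B u v = - B v u" "C u v = - C v u" for u v
    using B C unfolding antisymmetric_bilinear_def by blast+
  have "B u v + scale t (C u v) = - (B v u + scale t (C v u))" for u v
    by (subst (1 2) anti) simp
  then show ?thesis
    using vector_space_axioms
    by (simp add: antisymmetric_bilinear_def bilinear_map_def Vector_Spaces.linear_iff
        bilinear_mapD[OF bil(1)] bilinear_mapD[OF bil(2)] algebra_simps)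
qed

text \<open>Applying \<open>f\<close> and \<open>g\<close> to \<open>c a + d b + w\<close> kills
  \<open>w\<close> and returns \<open>c\<close> and \<open>d\<close>. Coordinates named by the
  functionals let the later identities be checked as algebra in their values.\<close>

lemma direct_sum_span_pair_dual_basis:
  assumes "vector_space scale"
    and "direct_sum_decomposition scale (module.span scale {a, b}) W"
    and f: "Vector_Spaces.linear scale (*) f" and g: "Vector_Spaces.linear scale (*) g"
    and dual: "f a = 1" "f b = 0" "g a = 0" "g b = 1" "\<forall>w\<in>W. f w = 0" "\<forall>w\<in>W. g w = 0"
  obtains w where "w \<in> W" "x = scale (f x) a + scale (g x) b + w"
proof -
  interpret vector_space scale by fact
  obtain u w where u: "u \<in> span {a, b}" and w: "w \<in> W" and x: "x = u + w"
    using assms(2) unfolding direct_sum_decomposition_def by blast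
  obtain c d where "u = scale c a + scale d b"
    using u by (auto simp: span_insert span_singleton algebra_simps)
  with x have "x = scale c a + scale d b + w" by simp
  moreover from this have "f x = c" "g x = d"
    using f g dual w by (simp_all add: Vector_Spaces.linear_iff)
  ultimately show thesis using that w by simp
qed

theorem theorem3p1:
  fixes scale :: "'k::{alg_closed_field, field_char_0} \<Rightarrow> 'g::ab_group_add \<Rightarrow> 'g"
    and Basis :: "'g set"
    and \<mu> :: "'g \<Rightarrow> 'g \<Rightarrow> 'g"
    and \<hh> :: "'g set"
    and a\<^sub>1 a\<^sub>2 y :: 'g
    and f\<^sub>1 f\<^sub>2 :: "'g \<Rightarrow> 'k"
  assumes "finite_dimensional_vector_space scale Basis"
    and "lie_bracket scale \<mu>"
    and "lie_subalgebra scale \<mu> \<hh>"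
    and "vector_space.dim scale (UNIV :: 'g set) = vector_space.dim scale \<hh> + 2"
    and "direct_sum_decomposition scale (module.span scale {a\<^sub>1, a\<^sub>2}) \<hh>"
    and "Vector_Spaces.linear scale (*) f\<^sub>1" and "Vector_Spaces.linear scale (*) f\<^sub>2"
    and "f\<^sub>1 a\<^sub>1 = 1" and "f\<^sub>1 a\<^sub>2 = 0" and "f\<^sub>2 a\<^sub>1 = 0" and "f\<^sub>2 a\<^sub>2 = 1"
    and "\<forall>h\<in>\<hh>. f\<^sub>1 h = 0" and "\<forall>h\<in>\<hh>. f\<^sub>2 h = 0"
    and "\<forall>h\<in>\<hh>. f\<^sub>1 (\<mu> a\<^sub>1 h) + f\<^sub>2 (\<mu> a\<^sub>2 h) = 0"
    and "\<forall>h\<in>\<hh>. \<mu> y h = 0"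
  shows "linear_deformation scale \<mu>
    (\<lambda>t u v. \<mu> u v + scale t (wedge_tensor scale f\<^sub>1 f\<^sub>2 y u v))"
proof -
  interpret finite_dimensional_vector_space scale Basis by fact
  note vs = vector_space_axioms
  define \<omega> where "\<omega> u v = f\<^sub>1 u * f\<^sub>2 v - f\<^sub>2 u * f\<^sub>1 v" for u v
  define \<phi> where "\<phi> = wedge_tensor scale f\<^sub>1 f\<^sub>2 y"
  have \<phi>: "\<phi> u v = scale (\<omega> u v) y" for u v
    by (simp add: \<phi>_def \<omega>_def wedge_tensor_def)
  have \<mu>: "antisymmetric_bilinear scale \<mu>" and bil: "bilinear_map scale \<mu>"
    and anti: "\<mu> u v = - \<mu> v u"
    and jacobi: "\<mu> (\<mu> u v) w + \<mu> (\<mu> v w) u + \<mu> (\<mu> w u) v = 0" for u v w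
    using assms(2) unfolding lie_bracket_def antisymmetric_bilinear_def by blast+
  have \<phi>_anti: "antisymmetric_bilinear scale \<phi>"
    unfolding \<phi>_def by (intro antisymmetric_bilinear_wedge_tensor assms)
  have bil\<phi>: "bilinear_map scale \<phi>"
    using \<phi>_anti unfolding antisymmetric_bilinear_def by blast
  note \<mu>_simps = bilinear_mapD[OF bil]
  have f_add: "f\<^sub>1 (u + v) = f\<^sub>1 u + f\<^sub>1 v" "f\<^sub>2 (u + v) = f\<^sub>2 u + f\<^sub>2 v"
    and f_scale: "f\<^sub>1 (scale c u) = c * f\<^sub>1 u" "f\<^sub>2 (scale c u) = c * f\<^sub>2 u" for c u v
    using assms(6,7) by (simp_all add: Vector_Spaces.linear_iff)
  have f_minus: "f\<^sub>1 (- u) = - f\<^sub>1 u" "f\<^sub>2 (- u) = - f\<^sub>2 u" for u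
    using f_scale[of "- 1" u] by simp_all
  have sub: "\<mu> h h' \<in> \<hh>" if "h \<in> \<hh>" "h' \<in> \<hh>" for h h'
    using assms(3) that by (simp add: lie_subalgebra_def)
  \<comment> \<open>Antisymmetry only makes twice this bracket vanish; characteristic zero cancels
    the 2.\<close>
  have self: "\<mu> u u = 0" for u
  proof -
    have "scale 2 (\<mu> u u) = \<mu> u u + \<mu> u u"
      using scale_left_distrib[of 1 1 "\<mu> u u"] by simp
    also have "\<dots> = 0"
      using anti[of u u] by (metis add.right_inverse)
    finally show ?thesis by simp
  qed
  note decomp = direct_sum_span_pair_dual_basis[OF vs assms(5-13)]
  have \<mu>y: "\<mu> y w = scale (f\<^sub>1 w) (\<mu> y a\<^sub>1) + scale (f\<^sub>2 w) (\<mu> y a\<^sub>2)" for w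
  proof -
    obtain h where h: "h \<in> \<hh>" and w: "w = scale (f\<^sub>1 w) a\<^sub>1 + scale (f\<^sub>2 w) a\<^sub>2 + h"
      using decomp .
    \<comment> \<open>The equation for \<open>w\<close> contains \<open>w\<close> on both sides and
      could loop as a rewrite rule, so \<open>arg_cong\<close> applies it once.\<close>
    have "\<mu> y w = \<mu> y (scale (f\<^sub>1 w) a\<^sub>1 + scale (f\<^sub>2 w) a\<^sub>2 + h)"
      using w by (rule arg_cong)
    with h assms(15) show ?thesis
      by (simp add: \<mu>_simps)
  qed
  have \<omega>\<mu>y: "scale (\<omega> u v) (\<mu> y w) + scale (\<omega> v w) (\<mu> y u) + scale (\<omega> w u) (\<mu> y v) = 0" for u v w
  proof -
    have "scale (\<omega> u v) (\<mu> y w) + scale (\<omega> v w) (\<mu> y u) + scale (\<omega> w u) (\<mu> y v)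
      = scale (\<omega> u v * f\<^sub>1 w + \<omega> v w * f\<^sub>1 u + \<omega> w u * f\<^sub>1 v) (\<mu> y a\<^sub>1)
      + scale (\<omega> u v * f\<^sub>2 w + \<omega> v w * f\<^sub>2 u + \<omega> w u * f\<^sub>2 v) (\<mu> y a\<^sub>2)"
      by (subst (1 2 3) \<mu>y) (simp add: scale_left_distrib scale_right_distrib)
    \<comment> \<open>This is the determinant with rows \<open>f\<^sub>1\<close>,
      \<open>f\<^sub>2\<close>, \<open>f\<^sub>1\<close> at \<open>u\<close>, \<open>v\<close>,
      \<open>w\<close>, expanded along the last row; the next one has last row
      \<open>f\<^sub>2\<close>.\<close>
    also have "\<omega> u v * f\<^sub>1 w + \<omega> v w * f\<^sub>1 u + \<omega> w u * f\<^sub>1 v = 0"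
      by (simp add: \<omega>_def algebra_simps)
    also have "\<omega> u v * f\<^sub>2 w + \<omega> v w * f\<^sub>2 u + \<omega> w u * f\<^sub>2 v = 0"
      by (simp add: \<omega>_def algebra_simps)
    finally show ?thesis by simp
  qed
  \<comment> \<open>A Pluecker relation: \<open>\<omega> y\<close> is a linear combination of
    \<open>f\<^sub>1\<close> and \<open>f\<^sub>2\<close>, so the same two determinants
    occur.\<close>
  have \<omega>\<omega>: "\<omega> u v * \<omega> y w + \<omega> v w * \<omega> y u + \<omega> w u * \<omega> y v = 0" for u v w
    by (simp add: \<omega>_def algebra_simps)
  \<comment> \<open>The components \<open>h\<close> and \<open>k\<close> are parameters, so that all
    three cyclic terms below can share one decomposition of each vector. Their mutual bracket lies
    in the subalgebra, where \<open>f\<close> vanishes.\<close>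
  have expand: "f (\<mu> u v) = \<omega> u v * f (\<mu> a\<^sub>1 a\<^sub>2)
      + f\<^sub>1 u * f (\<mu> a\<^sub>1 k) + f\<^sub>2 u * f (\<mu> a\<^sub>2 k) - f\<^sub>1 v * f (\<mu> a\<^sub>1 h) - f\<^sub>2 v * f (\<mu> a\<^sub>2 h)"
    if f: "f = f\<^sub>1 \<or> f = f\<^sub>2" and h: "h \<in> \<hh>" and k: "k \<in> \<hh>"
      and u: "u = scale (f\<^sub>1 u) a\<^sub>1 + scale (f\<^sub>2 u) a\<^sub>2 + h"
      and v: "v = scale (f\<^sub>1 v) a\<^sub>1 + scale (f\<^sub>2 v) a\<^sub>2 + k" for f u v h k
  proof -
    have add: "f (p + q) = f p + f q" and scl: "f (scale c p) = c * f p"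
      and diff: "f (p - q) = f p - f q" for c p q
      using f f_add f_scale f_add[of p "- q"] f_minus by auto
    have zero: "f (\<mu> k h) = 0"
      using f sub[OF k h] assms(12,13) by auto
    have "\<mu> u v =
        \<mu> (scale (f\<^sub>1 u) a\<^sub>1 + scale (f\<^sub>2 u) a\<^sub>2 + h) (scale (f\<^sub>1 v) a\<^sub>1 + scale (f\<^sub>2 v) a\<^sub>2 + k)"
      using u v by (rule arg_cong2)
    then have "f (\<mu> u v) = f \<dots>"
      by (rule arg_cong)
    then show ?thesis
      by (simp add: \<mu>_simps add scl diff zero self anti[of a\<^sub>2 a\<^sub>1] anti[of h] \<omega>_def algebra_simps)
  qed
  have \<omega>\<mu>: "\<omega> (\<mu> u v) w + \<omega> (\<mu> v w) u + \<omega> (\<mu> w u) v = 0" for u v w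
  proof -
    obtain h where h: "h \<in> \<hh>" "u = scale (f\<^sub>1 u) a\<^sub>1 + scale (f\<^sub>2 u) a\<^sub>2 + h" using decomp .
    obtain k where k: "k \<in> \<hh>" "v = scale (f\<^sub>1 v) a\<^sub>1 + scale (f\<^sub>2 v) a\<^sub>2 + k" using decomp .
    obtain l where l: "l \<in> \<hh>" "w = scale (f\<^sub>1 w) a\<^sub>1 + scale (f\<^sub>2 w) a\<^sub>2 + l" using decomp .
    note e = expand[OF _ h(1) k(1) h(2) k(2)] expand[OF _ k(1) l(1) k(2) l(2)]
      expand[OF _ l(1) h(1) l(2) h(2)]
    \<comment> \<open>The assumed vanishing says that \<open>x\<close> acts with trace zero on the
      quotient by \<open>\<hh>\<close>. In the cyclic sum the terms containing \<open>k\<close>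
      collect to \<open>\<omega> u w\<close> times this trace up to sign, and similarly for
      \<open>h\<close> and \<open>l\<close>; the terms from \<open>\<mu> a\<^sub>1 a\<^sub>2\<close>
      again form determinants with a repeated row.\<close>
    have tr: "f\<^sub>2 (\<mu> a\<^sub>2 x) = - f\<^sub>1 (\<mu> a\<^sub>1 x)" if "x \<in> \<hh>" for x
      using assms(14) that by (simp add: add_eq_0_iff)
    show ?thesis
      unfolding \<omega>_def[of "\<mu> _ _"]
      by (simp add: e tr h(1) k(1) l(1)) (simp add: \<omega>_def algebra_simps)
  qed
  have \<omega>_scale: "\<omega> (scale c u) v = c * \<omega> u v" for c u v
    by (simp add: \<omega>_def f_scale algebra_simps)
  have "lie_bracket scale (\<lambda>u v. \<mu> u v + scale t (\<phi> u v))" for t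
  proof -
    define \<nu> where "\<nu> u v = \<mu> u v + scale t (\<phi> u v)" for u v
    \<comment> \<open>The summands are, in order, \<mu> after \<mu>, \<mu> after \<phi>, \<phi>
      after \<mu> and \<phi> after \<phi>.\<close>
    have "\<nu> (\<nu> u v) w = \<mu> (\<mu> u v) w
      + scale t (scale (\<omega> u v) (\<mu> y w)) + scale t (scale (\<omega> (\<mu> u v) w) y)
      + scale (t * t) (scale (\<omega> u v * \<omega> y w) y)" for u v w
      unfolding \<nu>_def bilinear_mapD[OF bil\<phi>] \<mu>_simps
      by (simp add: \<phi> \<omega>_scale \<mu>_simps scale_right_distrib ac_simps)
    then have "\<nu> (\<nu> u v) w + \<nu> (\<nu> v w) u + \<nu> (\<nu> w u) v
      = (\<mu> (\<mu> u v) w + \<mu> (\<mu> v w) u + \<mu> (\<mu> w u) v)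
      + scale t (scale (\<omega> u v) (\<mu> y w) + scale (\<omega> v w) (\<mu> y u) + scale (\<omega> w u) (\<mu> y v))
      + scale t (scale (\<omega> (\<mu> u v) w + \<omega> (\<mu> v w) u + \<omega> (\<mu> w u) v) y)
      + scale (t * t) (scale (\<omega> u v * \<omega> y w + \<omega> v w * \<omega> y u + \<omega> w u * \<omega> y v) y)" for u v w
      by (simp add: scale_left_distrib scale_right_distrib ac_simps)
    then have "\<nu> (\<nu> u v) w + \<nu> (\<nu> v w) u + \<nu> (\<nu> w u) v = 0" for u v w
      by (simp only: jacobi \<omega>\<mu>y \<omega>\<mu> \<omega>\<omega>) simp
    then show ?thesis
      using antisymmetric_bilinear_add_scale[OF vs \<mu> \<phi>_anti]
      by (simp add: lie_bracket_def \<nu>_def)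
  qed
  with \<phi>_anti show ?thesis
    unfolding linear_deformation_def \<phi>_def by blast
qed

end
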